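(* Let $d\ge 1$. There exist substitutable homogeneous polynomials $F_2,\dots,F_d\in\mathbb{R}[a_1,\dots,a_d]$ such that for every real polynomial $f(x)=x^d+a_1x^{d-1}+\cdots+a_d$, $f$ has $d$ distinct real roots if and only if $$F_2(a_1,\dots,a_d)>0,\ \dots,\ F_d(a_1,\dots,a_d)>0.$$
   Context: For a monomial $a_1^{i_1}\cdots a_d^{i_d}$ the substituted homogeneous degree is $\mathrm{shd}(a_1^{i_1}\cdots a_d^{i_d})=\sum_{j=1}^d j\cdot i_j$. A polynomial in $\mathbb{R}[a_1,\dots,a_d]$ is called substitutable homogeneous if all its terms have the same substituted homogeneous degree. *)

theory Defs
  imports "HOL-Library.Poly_Mapping" "HOL-Computational_Algebra.Polynomial"
begin

text \<open>
  Multivariate real polynomials in variables indexed by \<^typ>\<open>nat\<close>: a monomial is a finitely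
  supported exponent map, a polynomial a finitely supported map from monomials to coefficients.
  The ring operations on these types are those of \<^theory>\<open>HOL-Library.Poly_Mapping\<close>.
\<close>

type_synonym monomial = "nat \<Rightarrow>\<^sub>0 nat"
type_synonym real_mpoly = "monomial \<Rightarrow>\<^sub>0 real"

text \<open>Variables are numbered from 1, as in \<open>\<real>[a\<^sub>1, \<dots>, a\<^sub>d]\<close>; index 0 is unused.\<close>

definition polys_in :: "nat \<Rightarrow> real_mpoly set" where
  "polys_in d = {F. \<forall>m \<in> Poly_Mapping.keys F. Poly_Mapping.keys m \<subseteq> {1..d}}"

definition mpoly_eval :: "real_mpoly \<Rightarrow> (nat \<Rightarrow> real) \<Rightarrow> real" where
  "mpoly_eval F a =
     (\<Sum>m \<in> Poly_Mapping.keys F.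
        Poly_Mapping.lookup F m * (\<Prod>j \<in> Poly_Mapping.keys m. a j ^ Poly_Mapping.lookup m j))"

text \<open>
  The substituted homogeneous degree. Variables outside the support of the monomial have exponent 0,
  so on monomials in \<open>a\<^sub>1, \<dots>, a\<^sub>d\<close> this is the sum over \<open>j = 1, \<dots>, d\<close>.
\<close>

definition shd :: "monomial \<Rightarrow> nat" where
  "shd m = (\<Sum>j \<in> Poly_Mapping.keys m. j * Poly_Mapping.lookup m j)"

definition substitutable_homogeneous :: "real_mpoly \<Rightarrow> bool" where
  "substitutable_homogeneous F \<longleftrightarrow>
     (\<forall>m \<in> Poly_Mapping.keys F. \<forall>m' \<in> Poly_Mapping.keys F. shd m = shd m')"

definition monic_poly :: "nat \<Rightarrow> (nat \<Rightarrow> real) \<Rightarrow> real poly" where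
  "monic_poly d a = monom 1 d + (\<Sum>i = 1..d. monom (a i) (d - i))"

end

theory Submission
  imports Defs "HOL-Computational_Algebra.Fundamental_Theorem_Algebra"
    "HOL-Computational_Algebra.Polynomial_FPS"
begin

text \<open>
  The proof goes through Hermite's quadratic form. Let \<open>z\<^sub>1, \<dots>, z\<^sub>d\<close> be the complex roots of \<open>f\<close>,
  with multiplicity, and \<open>p\<^sub>k\<close> the sum of their \<open>k\<close>-th powers. For a real polynomial \<open>q\<close> of degree
  below \<open>d\<close> with coefficients \<open>x\<^sub>0, \<dots>, x\<^bsub>d-1\<^esub>\<close>, the form \<open>\<Sum>\<^sub>i\<^sub>j p\<^bsub>i+j\<^esub> x\<^sub>i x\<^sub>j\<close> equals \<open>\<Sum>\<^sub>l q(z\<^sub>l)\<^sup>2\<close>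
  (lemma \<open>hermite_form\<close>). It is positive definite iff \<open>f\<close> has \<open>d\<close> distinct real roots
  (\<open>card_real_roots_iff_pos_def\<close>). If the roots are real and distinct, the form is a sum of real squares,
  and a nonzero \<open>q\<close> cannot vanish at all \<open>d\<close> roots. If there is a nonreal root \<open>w\<close>, some \<open>q \<noteq> 0\<close>
  vanishes at the roots other than \<open>w\<close> and its conjugate and takes a value in \<open>{0, \<i>, -\<i>}\<close> at
  these two, so the form is not positive at \<open>q\<close>. If the roots are real but
  there are fewer than \<open>d\<close> of them, the product of the \<open>X - r\<close> over the distinct roots \<open>r\<close> annihilates the form.

  Positive definiteness is tested by Gaussian elimination without division: completing the square
  in the variable \<open>x\<^sub>k\<close> and multiplying by the pivot \<open>H\<^sub>k\<^sub>k\<close> leaves the form with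
  coefficients \<open>H\<^sub>k\<^sub>k H\<^sub>i\<^sub>j - H\<^sub>i\<^sub>k H\<^sub>k\<^sub>j\<close>, and the form is positive definite iff all the pivots are positive
  (\<open>pos_def_iff_pivots\<close>). The first pivot is \<open>p\<^sub>0 = d > 0\<close>; the other \<open>d - 1\<close> pivots are the values of
  \<open>F\<^sub>2, \<dots>, F\<^sub>d\<close>.

  By Newton's identities (\<open>newton_identity\<close>), \<open>p\<^sub>k\<close> is given by a polynomial in \<open>a\<^sub>1, \<dots>, a\<^sub>d\<close> whose terms
  all have substituted homogeneous degree \<open>k\<close>. If the coefficients \<open>H\<^sub>i\<^sub>j\<close> are homogeneous of degree
  \<open>c + i + j\<close> for a constant \<open>c\<close>, the same holds after an elimination step with a new constant
  (\<open>weighted_reduced\<close>), so all pivots are substitutable homogeneous.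
\<close>

section \<open>Functions given by weighted homogeneous polynomials\<close>

text \<open>The value of a monomial at the point \<open>a\<close>.\<close>

definition monomial_val :: "monomial \<Rightarrow> (nat \<Rightarrow> real) \<Rightarrow> real" where
  "monomial_val m a = (\<Prod>j \<in> Poly_Mapping.keys m. a j ^ Poly_Mapping.lookup m j)"

text \<open>
  The function \<open>f\<close> of the coefficient sequence is the evaluation of a polynomial in \<open>a\<^sub>1, \<dots>, a\<^sub>d\<close>
  all of whose terms have substituted homogeneous degree \<open>w\<close>. Closure under sums and
  products is proved for functions, so evaluation never has to be shown to be multiplicative.
\<close>

definition weighted :: "nat \<Rightarrow> nat \<Rightarrow> ((nat \<Rightarrow> real) \<Rightarrow> real) \<Rightarrow> bool" where
  "weighted d w f \<longleftrightarrow>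
     (\<exists>F \<in> polys_in d. (\<forall>m \<in> Poly_Mapping.keys F. shd m = w) \<and> (\<forall>a. mpoly_eval F a = f a))"

lemma monomial_val_superset:
  assumes "finite J" "Poly_Mapping.keys m \<subseteq> J"
  shows "monomial_val m a = (\<Prod>j\<in>J. a j ^ Poly_Mapping.lookup m j)"
  unfolding monomial_val_def
  by (rule prod.mono_neutral_left) (use assms in \<open>auto simp: in_keys_iff\<close>)

lemma shd_superset:
  assumes "finite J" "Poly_Mapping.keys m \<subseteq> J"
  shows "shd m = (\<Sum>j\<in>J. j * Poly_Mapping.lookup m j)"
  unfolding shd_def
  by (rule sum.mono_neutral_left) (use assms in \<open>auto simp: in_keys_iff\<close>)

lemma mpoly_eval_superset:
  assumes "finite K" "Poly_Mapping.keys F \<subseteq> K"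
  shows "mpoly_eval F a = (\<Sum>m\<in>K. Poly_Mapping.lookup F m * monomial_val m a)"
  unfolding mpoly_eval_def monomial_val_def
  by (rule sum.mono_neutral_left) (use assms in \<open>auto simp: in_keys_iff\<close>)

lemma monomial_val_add: "monomial_val (m + n) a = monomial_val m a * monomial_val n a"
proof -
  let ?J = "Poly_Mapping.keys m \<union> Poly_Mapping.keys n"
  have "Poly_Mapping.keys (m + n) \<subseteq> ?J" by (rule Poly_Mapping.keys_add)
  then show ?thesis
    by (simp add: monomial_val_superset[of ?J] lookup_add power_add prod.distrib)
qed

lemma shd_add: "shd (m + n) = shd m + shd n"
proof -
  let ?J = "Poly_Mapping.keys m \<union> Poly_Mapping.keys n"
  have "Poly_Mapping.keys (m + n) \<subseteq> ?J" by (rule Poly_Mapping.keys_add)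
  then show ?thesis
    by (simp add: shd_superset[of ?J] lookup_add distrib_left sum.distrib)
qed

lemma weighted_zero: "weighted d w (\<lambda>a. 0)"
  unfolding weighted_def by (rule bexI[of _ 0]) (auto simp: mpoly_eval_def polys_in_def)

lemma weighted_monomial:
  assumes "Poly_Mapping.keys m \<subseteq> {1..d}"
  shows "weighted d (shd m) (\<lambda>a. c * monomial_val m a)"
  unfolding weighted_def
  by (rule bexI[of _ "Poly_Mapping.single m c"])
    (use assms in \<open>auto simp: mpoly_eval_superset[of "{m}"] polys_in_def split: if_splits\<close>)

lemma weighted_const: "weighted d 0 (\<lambda>a. c)"
  using weighted_monomial[of 0 d c] by (simp add: shd_def monomial_val_def)

lemma weighted_var:
  assumes "j \<in> {1..d}"
  shows "weighted d j (\<lambda>a. a j)"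
  using weighted_monomial[of "Poly_Mapping.single j 1" d 1] assms
  by (simp add: shd_def monomial_val_def)

lemma weighted_add:
  assumes "weighted d w f" "weighted d w g"
  shows "weighted d w (\<lambda>a. f a + g a)"
proof -
  obtain F G where F: "F \<in> polys_in d" "\<forall>m \<in> Poly_Mapping.keys F. shd m = w" "\<forall>a. mpoly_eval F a = f a"
    and G: "G \<in> polys_in d" "\<forall>m \<in> Poly_Mapping.keys G. shd m = w" "\<forall>a. mpoly_eval G a = g a"
    using assms unfolding weighted_def by blast
  let ?K = "Poly_Mapping.keys F \<union> Poly_Mapping.keys G"
  have K: "Poly_Mapping.keys (F + G) \<subseteq> ?K" by (rule Poly_Mapping.keys_add)
  have "mpoly_eval (F + G) a = mpoly_eval F a + mpoly_eval G a" for a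
    using K by (simp add: mpoly_eval_superset[of ?K] lookup_add distrib_right sum.distrib)
  moreover have "F + G \<in> polys_in d" "\<forall>m \<in> Poly_Mapping.keys (F + G). shd m = w"
    using K F G unfolding polys_in_def by blast+
  ultimately show ?thesis
    using F(3) G(3) unfolding weighted_def by auto
qed

lemma weighted_sum:
  assumes "\<And>i. i \<in> I \<Longrightarrow> weighted d w (f i)"
  shows "weighted d w (\<lambda>a. \<Sum>i\<in>I. f i a)"
  using assms
  by (induction I rule: infinite_finite_induct) (auto intro: weighted_zero weighted_add)

lemma weighted_mult:
  assumes "weighted d v f" "weighted d w g"
  shows "weighted d (v + w) (\<lambda>a. f a * g a)"
proof -
  obtain F G where F: "F \<in> polys_in d" "\<forall>m \<in> Poly_Mapping.keys F. shd m = v" "\<forall>a. mpoly_eval F a = f a"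
    and G: "G \<in> polys_in d" "\<forall>m \<in> Poly_Mapping.keys G. shd m = w" "\<forall>a. mpoly_eval G a = g a"
    using assms unfolding weighted_def by blast
  have eq: "f a * g a = (\<Sum>m\<in>Poly_Mapping.keys F. \<Sum>n\<in>Poly_Mapping.keys G.
      (Poly_Mapping.lookup F m * Poly_Mapping.lookup G n) * monomial_val (m + n) a)" for a
    by (simp flip: F(3)[rule_format] G(3)[rule_format]
        add: mpoly_eval_def monomial_val_def[symmetric] sum_product monomial_val_add mult_ac)
  have "weighted d (v + w) (\<lambda>a. (Poly_Mapping.lookup F m * Poly_Mapping.lookup G n) * monomial_val (m + n) a)"
    if "m \<in> Poly_Mapping.keys F" "n \<in> Poly_Mapping.keys G" for m n
  proof -
    have "Poly_Mapping.keys (m + n) \<subseteq> {1..d}"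
      using that F(1) G(1) Poly_Mapping.keys_add[of m n] unfolding polys_in_def by blast
    moreover have "shd (m + n) = v + w"
      using that F(2) G(2) by (simp add: shd_add)
    ultimately show ?thesis using weighted_monomial[of "m + n" d] by metis
  qed
  then show ?thesis
    unfolding eq by (intro weighted_sum)
qed

lemma weighted_diff:
  assumes "weighted d w f" "weighted d w g"
  shows "weighted d w (\<lambda>a. f a - g a)"
  using weighted_add[of d w f "\<lambda>a. - 1 * g a"] weighted_mult[OF weighted_const[of d "-1"] assms(2)] assms(1)
  by simp

section \<open>Power sums of the roots\<close>

text \<open>
  The sum of the \<open>k\<close>-th powers of the complex roots of \<open>x^d + a\<^sub>1 x^(d-1) + \<dots> + a\<^sub>d\<close>, computed from
  the coefficients by Newton's identities. The coefficients \<open>a\<^sub>j\<close> with \<open>j > d\<close> count as zero, whence the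
  bound \<open>min k d\<close>; for \<open>k = 0\<close> the value is \<open>d\<close>.
\<close>

fun power_sum :: "nat \<Rightarrow> (nat \<Rightarrow> real) \<Rightarrow> nat \<Rightarrow> real" where
  "power_sum d a k =
     (if k = 0 then real d else if k \<le> d then (real d - real k) * a k else 0)
     - (\<Sum>j = 1..min k d. a j * power_sum d a (k - j))"

(* The equation is unconditional and recursive: as a rewrite rule it would unfold forever. *)
declare power_sum.simps [simp del]

lemma power_sum_0: "power_sum d a 0 = real d"
  by (subst power_sum.simps) simp

lemma weighted_power_sum: "weighted d k (\<lambda>a. power_sum d a k)"
proof (induction k rule: less_induct)
  case (less k)
  have 1: "weighted d k (\<lambda>a. if k = 0 then real d else if k \<le> d then (real d - real k) * a k else 0)"
    using weighted_mult[OF weighted_const weighted_var[of k d], of "real d - real k"]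
    by (cases "k = 0"; cases "k \<le> d") (simp_all add: weighted_zero weighted_const)
  have 2: "weighted d k (\<lambda>a. a j * power_sum d a (k - j))" if "j \<in> {1..min k d}" for j
    using weighted_mult[OF weighted_var[of j d] less[of "k - j"]] that by simp
  have "weighted d k (\<lambda>a. (if k = 0 then real d else if k \<le> d then (real d - real k) * a k else 0)
     - (\<Sum>j = 1..min k d. a j * power_sum d a (k - j)))"
    by (intro weighted_diff 1 weighted_sum 2)
  then show ?case by (simp only: power_sum.simps[symmetric])
qed

text \<open>
  Generating function form of Newton's identities: with \<open>E = \<Prod>\<^sub>i (1 - z\<^sub>i X)\<close> and \<open>P = \<Sum>\<^sub>k p\<^sub>k X\<^sup>k\<close>, the
  logarithmic derivative of \<open>E\<close> gives \<open>E P = n E - X E'\<close>.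
\<close>

lemma newton_fps:
  fixes z :: "nat \<Rightarrow> 'a :: field"
  defines "E \<equiv> (\<lambda>n. \<Prod>i<n. 1 - fps_const (z i) * fps_X)"
  shows "E n * Abs_fps (\<lambda>k. \<Sum>i<n. z i ^ k) = of_nat n * E n - fps_X * fps_deriv (E n)"
proof (induction n)
  case 0
  then show ?case by (simp add: E_def fps_zero_def[symmetric])
next
  case (Suc n)
  let ?L = "1 - fps_const (z n) * fps_X" and ?G = "Abs_fps (\<lambda>k. z n ^ k)"
  let ?P = "\<lambda>n. Abs_fps (\<lambda>k. \<Sum>i<n. z i ^ k)"
  have G: "?L * ?G = 1"
  proof (rule fps_ext)
    fix k show "fps_nth (?L * ?G) k = fps_nth 1 k"
      by (cases k) (simp_all add: left_diff_distrib mult.assoc)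
  qed
  have P: "?P (Suc n) = ?P n + ?G" by (rule fps_ext) simp
  have E: "E (Suc n) = E n * ?L" by (simp add: E_def)
  have "E (Suc n) * ?P (Suc n) = ?L * (E n * ?P n) + E n * (?L * ?G)"
    unfolding P E by (simp add: algebra_simps)
  also have "\<dots> = ?L * (of_nat n * E n - fps_X * fps_deriv (E n)) + E n"
    by (simp only: Suc.IH G mult_1_right)
  also have "\<dots> = of_nat (Suc n) * E (Suc n) - fps_X * fps_deriv (E (Suc n))"
    unfolding E by (simp add: algebra_simps)
  finally show ?case .
qed

text \<open>
  Here \<open>e j\<close> is the \<open>j\<close>-th coefficient of \<open>p\<close> counted from the leading one, that is, the \<open>j\<close>-th
  coefficient of the reflected polynomial \<open>\<Prod>\<^sub>i (1 - z\<^sub>i X)\<close>.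
\<close>

lemma newton_identity:
  fixes z :: "nat \<Rightarrow> 'a :: field" and p :: "'a poly"
  assumes p: "p = (\<Prod>i<d. [:- z i, 1:])"
  defines "e \<equiv> (\<lambda>j. if j \<le> d then coeff p (d - j) else 0)"
  shows "(\<Sum>j=0..k. e j * (\<Sum>i<d. z i ^ (k - j))) = (of_nat d - of_nat k) * e k"
proof -
  let ?E = "\<Prod>i<d. 1 - fps_const (z i) * fps_X"
  have deg: "degree p = d" unfolding p by (subst degree_prod_eq_sum_degree) auto
  have "fps_of_poly (reflect_poly p) = ?E"
    unfolding p reflect_poly_prod fps_of_poly_prod
    by (intro prod.cong refl) (simp add: reflect_poly_pCons' fps_of_poly_pCons fps_of_poly_const monom_Suc monom_0 mult.commute)
  then have e: "fps_nth ?E j = e j" for j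
    unfolding e_def by (auto simp flip: \<open>fps_of_poly _ = _\<close> simp: coeff_reflect_poly deg)
  have "(\<Sum>j=0..k. e j * (\<Sum>i<d. z i ^ (k - j))) = fps_nth (?E * Abs_fps (\<lambda>k. \<Sum>i<d. z i ^ k)) k"
    by (simp add: fps_mult_nth e)
  also have "\<dots> = fps_nth (of_nat d * ?E) k - fps_nth (fps_X * fps_deriv ?E) k"
    unfolding newton_fps by simp
  also have "fps_nth (of_nat d * ?E) k = of_nat d * e k"
    by (simp add: e fps_of_nat[symmetric])
  also have "fps_nth (fps_X * fps_deriv ?E) k = of_nat k * e k"
    by (cases k) (simp_all add: e)
  finally show ?thesis by (simp add: algebra_simps)
qed

section \<open>Positive definite forms and division-free elimination\<close>

text \<open>The value at \<open>x\<close> of the quadratic form with coefficients \<open>H i j\<close>, for \<open>i, j \<in> I\<close>.\<close>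

definition qform :: "nat set \<Rightarrow> (nat \<Rightarrow> nat \<Rightarrow> real) \<Rightarrow> (nat \<Rightarrow> real) \<Rightarrow> real" where
  "qform I H x = (\<Sum>i\<in>I. \<Sum>j\<in>I. H i j * x i * x j)"

text \<open>Positive definiteness of that form; values of \<open>x\<close> outside \<open>I\<close> are irrelevant.\<close>

definition pos_def_on :: "nat set \<Rightarrow> (nat \<Rightarrow> nat \<Rightarrow> real) \<Rightarrow> bool" where
  "pos_def_on I H \<longleftrightarrow> (\<forall>x. (\<exists>i\<in>I. x i \<noteq> 0) \<longrightarrow> qform I H x > 0)"

text \<open>
  One step of division-free Gaussian elimination with pivot \<open>H k k\<close>. For symmetric \<open>H\<close>, row and column
  \<open>k\<close> become zero, and what remains is \<open>H k k\<close> times the Schur complement.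
\<close>

definition eliminate :: "nat \<Rightarrow> (nat \<Rightarrow> nat \<Rightarrow> real) \<Rightarrow> nat \<Rightarrow> nat \<Rightarrow> real" where
  "eliminate k H i j = H k k * H i j - H i k * H k j"

text \<open>Completing the square, multiplied by the pivot.\<close>

lemma qform_eliminate:
  assumes sym: "\<And>i j. H i j = H j i"
  shows "qform I (eliminate k H) x = H k k * qform I H x - (\<Sum>i\<in>I. H k i * x i)\<^sup>2"
proof -
  have "(\<Sum>i\<in>I. H k i * x i)\<^sup>2 = (\<Sum>i\<in>I. \<Sum>j\<in>I. (H i k * H k j) * x i * x j)"
    by (simp add: power2_eq_square sum_product sym[of _ k] mult_ac)
  then show ?thesis
    by (simp add: qform_def eliminate_def sum_distrib_left left_diff_distrib sum_subtractf mult.assoc)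
qed

lemma qform_eliminate_insert:
  assumes "finite I" "k \<notin> I" and sym: "\<And>i j. H i j = H j i"
  shows "qform I (eliminate k H) x = qform (insert k I) (eliminate k H) x"
proof -
  have "eliminate k H k j = 0" "eliminate k H j k = 0" for j
    by (simp_all add: eliminate_def sym[of j k])
  then show ?thesis using assms by (simp add: qform_def)
qed

lemma pos_def_on_eliminate:
  assumes I: "finite I" "k \<notin> I" and sym: "\<And>i j. H i j = H j i"
  shows "pos_def_on (insert k I) H \<longleftrightarrow> H k k > 0 \<and> pos_def_on I (eliminate k H)"
proof -
  let ?J = "insert k I" and ?H = "eliminate k H"
  have id: "H k k * qform ?J H x = qform I ?H x + (\<Sum>i\<in>?J. H k i * x i)\<^sup>2" for x
    using qform_eliminate[of H ?J k x] qform_eliminate_insert[of I k H x] assms by simp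
  show ?thesis
  proof (intro iffI conjI)
    assume pd: "pos_def_on ?J H"
    let ?e = "\<lambda>i. if i = k then 1 else 0 :: real"
    have "qform ?J H ?e = H k k"
      using I by (simp add: qform_def if_distrib[of "\<lambda>t. _ * t"] cong: if_cong)
    moreover have "qform ?J H ?e > 0" using pd unfolding pos_def_on_def by auto
    ultimately show pos: "H k k > 0" by simp
    show "pos_def_on I ?H"
      unfolding pos_def_on_def
    proof (intro allI impI)
      fix x :: "nat \<Rightarrow> real" assume x: "\<exists>i\<in>I. x i \<noteq> 0"
      \<comment> \<open>The entry at \<open>k\<close> is chosen to make the completed square vanish.\<close>
      define y where "y = x(k := - (\<Sum>i\<in>I. H k i * x i) / H k k)"
      have yI: "y i = x i" if "i \<in> I" for i using that I by (auto simp: y_def)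
      have "(\<Sum>i\<in>?J. H k i * y i) = 0"
        using I pos by (simp add: yI) (simp add: y_def)
      moreover have "qform I ?H y = qform I ?H x" by (simp add: qform_def yI)
      moreover have "qform ?J H y > 0" using pd x yI unfolding pos_def_on_def by auto
      ultimately show "qform I ?H x > 0" using id[of y] mult_pos_pos[OF pos] by fastforce
    qed
  next
    assume as: "H k k > 0 \<and> pos_def_on I ?H"
    show "pos_def_on ?J H"
      unfolding pos_def_on_def
    proof (intro allI impI)
      fix x :: "nat \<Rightarrow> real" assume x: "\<exists>i\<in>?J. x i \<noteq> 0"
      have "qform I ?H x + (\<Sum>i\<in>?J. H k i * x i)\<^sup>2 > 0"
      proof (cases "\<exists>i\<in>I. x i \<noteq> 0")
        case True
        then have "qform I ?H x > 0" using as by (auto simp: pos_def_on_def)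
        then show ?thesis by (simp add: add_pos_nonneg)
      next
        case False
        then have "x k \<noteq> 0" "qform I ?H x = 0" "(\<Sum>i\<in>?J. H k i * x i) = H k k * x k"
          using x I by (auto simp: qform_def)
        then show ?thesis using as by simp
      qed
      then show "qform ?J H x > 0" using as unfolding id[symmetric] by (simp add: zero_less_mult_iff)
    qed
  qed
qed

text \<open>
  The coefficients after \<open>k\<close> elimination steps, with pivots taken in the order \<open>0, 1, \<dots>\<close>. The entry
  \<open>reduced H k k k\<close> is the next pivot.
\<close>

primrec reduced :: "(nat \<Rightarrow> nat \<Rightarrow> real) \<Rightarrow> nat \<Rightarrow> nat \<Rightarrow> nat \<Rightarrow> real" where
  "reduced H 0 = H"
| "reduced H (Suc k) = eliminate k (reduced H k)"

lemma reduced_sym: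
  assumes "\<And>i j. H i j = H j i"
  shows "reduced H k i j = reduced H k j i"
proof (induction k arbitrary: i j)
  case (Suc k)
  show ?case
    using Suc[of i j] Suc[of i k] Suc[of j k] by (simp add: eliminate_def)
qed (simp add: assms)

lemma pos_def_iff_pivots:
  assumes sym: "\<And>i j. H i j = H j i"
  shows "pos_def_on {..<n} H \<longleftrightarrow> (\<forall>k<n. reduced H k k k > 0)"
proof -
  have "pos_def_on {m..<n} (reduced H m) \<longleftrightarrow> (\<forall>k\<in>{m..<n}. reduced H k k k > 0)" if "m \<le> n" for m
    using that
  proof (induction rule: inc_induct)
    case base
    then show ?case by (simp add: pos_def_on_def)
  next
    case (step m)
    have "{m..<n} = insert m {Suc m..<n}" using step by auto
    then show ?case
      using pos_def_on_eliminate[of "{Suc m..<n}" m "reduced H m"] reduced_sym[OF sym] step.IH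
      by simp
  qed
  from this[of 0] show ?thesis by (auto simp: atLeast0LessThan)
qed

text \<open>
  If \<open>c\<close> is the constant after \<open>k\<close> steps, then \<open>2c + 2k\<close> is the one after \<open>k + 1\<close> steps: both
  products in the elimination step involve the row or column index \<open>k\<close> twice.
\<close>

lemma weighted_reduced:
  assumes "\<And>i j. weighted d (i + j) (\<lambda>a. H a i j)"
  shows "\<exists>c. \<forall>i j. weighted d (c + i + j) (\<lambda>a. reduced (H a) k i j)"
proof (induction k)
  case 0
  show ?case using assms by (intro exI[of _ 0]) simp
next
  case (Suc k)
  then obtain c where c: "\<And>i j. weighted d (c + i + j) (\<lambda>a. reduced (H a) k i j)" by blast
  have "weighted d (2 * c + 2 * k + i + j) (\<lambda>a. reduced (H a) (Suc k) i j)" for i j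
  proof -
    have 1: "c + k + k + (c + i + j) = 2 * c + 2 * k + i + j"
      and 2: "c + i + k + (c + k + j) = 2 * c + 2 * k + i + j" by simp_all
    show ?thesis
      using weighted_diff[OF weighted_mult[OF c[of k k] c[of i j], unfolded 1]
          weighted_mult[OF c[of i k] c[of k j], unfolded 2]]
      by (simp add: eliminate_def)
  qed
  then show ?case by blast
qed

section \<open>Hermite's form\<close>

lemma poly_map_of_real:
  "poly (map_poly complex_of_real p) (complex_of_real x) = complex_of_real (poly p x)"
  by (induction p) (simp_all add: map_poly_pCons)

lemma map_poly_of_real_add:
  "map_poly complex_of_real (p + q) = map_poly complex_of_real p + map_poly complex_of_real q"
  by (rule poly_eqI) (simp add: coeff_map_poly)

lemma map_poly_of_real_mult:
  "map_poly complex_of_real (p * q) = map_poly complex_of_real p * map_poly complex_of_real q"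
  by (rule poly_eqI) (simp add: coeff_map_poly coeff_mult)

lemma coeff_monic_poly:
  "coeff (monic_poly d a) (d - j) = (if j = 0 then 1 else a j)" if "j \<le> d"
proof -
  have "(\<Sum>i = 1..d. if d - i = d - j then a i else 0) = (\<Sum>i = 1..d. if i = j then a i else 0)"
    using that by (intro sum.cong) auto
  then show ?thesis
    using that by (auto simp: monic_poly_def coeff_sum)
qed

lemma degree_monic_poly: "degree (monic_poly d a) = d"
proof (rule antisym)
  show "degree (monic_poly d a) \<le> d"
    unfolding monic_poly_def
    by (intro degree_add_le degree_sum_le) (auto intro: order.trans[OF degree_monom_le])
  show "d \<le> degree (monic_poly d a)"
    by (rule le_degree) (use coeff_monic_poly[where j = 0 and d = d and a = a] in simp)
qed

lemma complex_factorization: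
  fixes f :: "real poly"
  assumes "lead_coeff f = 1"
  obtains z where "map_poly complex_of_real f = (\<Prod>l<degree f. [:- z l, 1:])"
proof -
  let ?C = "map_poly complex_of_real f"
  have deg: "degree ?C = degree f" by (rule degree_map_poly) simp
  then have lc: "lead_coeff ?C = 1" using assms by (simp add: coeff_map_poly)
  then have "?C \<noteq> 0" by auto
  from alg_closed_imp_factorization[OF this] lc deg
  obtain A where A: "size A = degree f" "?C = (\<Prod>x\<in>#A. [:-x, 1:])" by auto
  obtain xs where "mset xs = A" using ex_mset by blast
  then have xs: "length xs = degree f" "?C = prod_list (map (\<lambda>x. [:-x, 1:]) xs)"
    using A by (auto simp flip: prod_mset_prod_list)
  then have "?C = (\<Prod>l<degree f. [:- xs ! l, 1:])"
    by (simp add: prod.list_conv_set_nth atLeast0LessThan)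
  then show ?thesis by (rule that)
qed

lemma of_real_power_sum:
  assumes z: "map_poly complex_of_real (monic_poly d a) = (\<Prod>l<d. [:- z l, 1:])"
  shows "complex_of_real (power_sum d a k) = (\<Sum>l<d. z l ^ k)"
proof (induction k rule: less_induct)
  case (less k)
  define S where "S k = (\<Sum>l<d. z l ^ k)" for k
  define e where "e j = (if j \<le> d then coeff (map_poly complex_of_real (monic_poly d a)) (d - j) else 0)" for j
  have e: "e j = (if j = 0 then 1 else if j \<le> d then complex_of_real (a j) else 0)" for j
    using coeff_monic_poly[where j = 0 and d = d and a = a] coeff_monic_poly[where j = j and d = d and a = a]
    by (auto simp: e_def coeff_map_poly)
  have "(\<Sum>j=0..k. e j * S (k - j)) = (of_nat d - of_nat k) * e k"
    using newton_identity[OF z, of k] unfolding S_def e_def .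
  also have "(\<Sum>j=0..k. e j * S (k - j)) = S k + (\<Sum>j=1..k. e j * S (k - j))"
    by (simp add: sum.atLeast_Suc_atMost[of 0] e)
  also have "(\<Sum>j=1..k. e j * S (k - j)) = (\<Sum>j=1..min k d. e j * S (k - j))"
    by (rule sum.mono_neutral_right) (auto simp: e)
  also have "\<dots> = (\<Sum>j=1..min k d. complex_of_real (a j * power_sum d a (k - j)))"
    by (intro sum.cong) (auto simp: e less S_def)
  finally have "S k = (of_nat d - of_nat k) * e k
      - (\<Sum>j=1..min k d. complex_of_real (a j * power_sum d a (k - j)))"
    by (simp add: algebra_simps)
  also have "\<dots> = complex_of_real (power_sum d a k)"
    by (subst power_sum.simps) (simp add: e)
  finally show ?case by (simp add: S_def)
qed

text \<open>The coefficients of Hermite's form, a Hankel matrix indexed from 0.\<close>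

definition hermite :: "nat \<Rightarrow> (nat \<Rightarrow> real) \<Rightarrow> nat \<Rightarrow> nat \<Rightarrow> real" where
  "hermite d a i j = power_sum d a (i + j)"

lemma poly_sum_below:
  fixes p :: "'a :: comm_semiring_1 poly"
  assumes "degree p < d"
  shows "poly p x = (\<Sum>i<d. coeff p i * x ^ i)"
  unfolding poly_altdef
  by (rule sum.mono_neutral_left) (use assms in \<open>auto simp: coeff_eq_0\<close>)

lemma hermite_form:
  assumes z: "map_poly complex_of_real (monic_poly d a) = (\<Prod>l<d. [:- z l, 1:])"
    and q: "degree q < d"
  shows "complex_of_real (qform {..<d} (hermite d a) (coeff q))
    = (\<Sum>l<d. (poly (map_poly complex_of_real q) (z l))\<^sup>2)"
proof -
  let ?c = "\<lambda>i. complex_of_real (coeff q i)"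
  have "degree (map_poly complex_of_real q) < d"
    using q by (simp add: degree_map_poly)
  then have "poly (map_poly complex_of_real q) w = (\<Sum>i<d. ?c i * w ^ i)" for w
    by (simp add: poly_sum_below coeff_map_poly)
  then have "(\<Sum>l<d. (poly (map_poly complex_of_real q) (z l))\<^sup>2)
      = (\<Sum>l<d. \<Sum>i<d. \<Sum>j<d. z l ^ (i + j) * ?c i * ?c j)"
    by (simp add: power2_eq_square sum_product power_add mult_ac)
  also have "\<dots> = (\<Sum>i<d. \<Sum>l<d. \<Sum>j<d. z l ^ (i + j) * ?c i * ?c j)"
    by (rule sum.swap)
  also have "\<dots> = (\<Sum>i<d. \<Sum>j<d. \<Sum>l<d. z l ^ (i + j) * ?c i * ?c j)"
    by (intro sum.cong refl sum.swap)
  finally show ?thesis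
    by (simp add: qform_def hermite_def of_real_power_sum[OF z] sum_distrib_right)
qed

lemma pos_def_on_iff_poly:
  "pos_def_on {..<d} H \<longleftrightarrow> (\<forall>q. q \<noteq> 0 \<and> degree q < d \<longrightarrow> qform {..<d} H (coeff q) > 0)"
proof (intro iffI allI impI)
  fix q :: "real poly"
  assume "pos_def_on {..<d} H" and q: "q \<noteq> 0 \<and> degree q < d"
  moreover have "coeff q (degree q) \<noteq> 0" using q by simp
  ultimately show "qform {..<d} H (coeff q) > 0" unfolding pos_def_on_def by blast
next
  assume as: "\<forall>q. q \<noteq> 0 \<and> degree q < d \<longrightarrow> qform {..<d} H (coeff q) > 0"
  show "pos_def_on {..<d} H"
    unfolding pos_def_on_def
  proof (intro allI impI)
    fix x :: "nat \<Rightarrow> real" assume "\<exists>i\<in>{..<d}. x i \<noteq> 0"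
    then obtain i where i: "i < d" "x i \<noteq> 0" by auto
    define q where "q = (\<Sum>i<d. monom (x i) i)"
    have c: "coeff q j = (if j < d then x j else 0)" for j by (simp add: q_def coeff_sum)
    have "q \<noteq> 0" using i c[of i] by auto
    moreover have "degree q < d"
      using i by (intro degree_lessI) (auto simp: c)
    ultimately have "qform {..<d} H (coeff q) > 0" using as by blast
    then show "qform {..<d} H x > 0" by (simp add: qform_def c)
  qed
qed

lemma quadratic_dvd_of_nonreal_root:
  fixes f :: "real poly"
  assumes root: "poly (map_poly complex_of_real f) w = 0" and w: "Im w \<noteq> 0"
  shows "[:(cmod w)\<^sup>2, - 2 * Re w, 1:] dvd f"
proof -
  let ?Q = "[:(cmod w)\<^sup>2, - 2 * Re w, 1:]"
  define r where "r = f mod ?Q"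
  have "degree r < 2" unfolding r_def using degree_mod_less'[of ?Q f] by (cases "r = 0") (auto simp: r_def)
  then have r: "r = [:coeff r 0, coeff r 1:]"
    by (intro poly_eqI) (auto simp: coeff_pCons coeff_eq_0 split: nat.splits)
  have "poly (map_poly complex_of_real ?Q) w = 0"
    by (simp add: map_poly_pCons complex_eq_iff cmod_power2) (simp add: power2_eq_square algebra_simps)
  moreover have "map_poly complex_of_real f = map_poly complex_of_real (?Q * (f div ?Q)) + map_poly complex_of_real r"
    unfolding r_def map_poly_of_real_add[symmetric] by (simp only: mult_div_mod_eq)
  ultimately have "poly (map_poly complex_of_real r) w = 0"
    using root by (simp only: map_poly_of_real_mult) simp
  then have "complex_of_real (coeff r 0) + w * complex_of_real (coeff r 1) = 0"
    by (subst (asm) r) (simp add: map_poly_pCons)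
  then have "coeff r 1 = 0" "coeff r 0 = 0" using w by (auto simp: complex_eq_iff)
  then have "r = 0" using r by simp
  then show ?thesis by (simp add: r_def dvd_eq_mod_eq_0)
qed

text \<open>
  If \<open>w\<close> is a nonreal root and \<open>f = (X - w)(X - cnj w) g\<close>, a real linear factor multiplied by \<open>g\<close> gives
  the polynomial \<open>q\<close> at which the form is not positive.
\<close>

lemma pos_def_hermite_imp_real:
  assumes z: "map_poly complex_of_real (monic_poly d a) = (\<Prod>l<d. [:- z l, 1:])"
    and pd: "pos_def_on {..<d} (hermite d a)"
    and m: "m < d"
  shows "Im (z m) = 0"
proof (rule ccontr)
  define w where "w = z m"
  define f where "f = monic_poly d a"
  assume "Im (z m) \<noteq> 0"
  then have w: "Im w \<noteq> 0" by (simp add: w_def)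
  let ?c = "map_poly complex_of_real"
  let ?Q = "[:(cmod w)\<^sup>2, - 2 * Re w, 1:]"
  have root: "poly (?c f) (z l) = 0" if "l < d" for l
    using that unfolding f_def z by (auto simp: poly_prod)
  obtain g where g: "f = ?Q * g"
    using quadratic_dvd_of_nonreal_root[OF root[OF m, folded w_def] w] by (elim dvdE)
  have "f \<noteq> 0" using m degree_monic_poly[of d a] by (auto simp: f_def)
  then have "g \<noteq> 0" using g by auto
  then have deg: "degree g + 2 = d"
    using degree_monic_poly[of d a] unfolding f_def[symmetric] g by (subst (asm) degree_mult_eq) auto
  \<comment> \<open>A real linear polynomial can take any prescribed value \<open>t\<close> at the nonreal point \<open>w\<close>;
    \<open>t\<close> is chosen so that \<open>q = g * [:\<beta>, \<alpha>:]\<close> has the value \<open>\<i>\<close> at \<open>w\<close>, or \<open>0\<close> if \<open>w\<close> is a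
    multiple root.\<close>
  define t where "t = (if poly (?c g) w = 0 then 1 else \<i> / poly (?c g) w)"
  define \<alpha> \<beta> where "\<alpha> = Im t / Im w" and "\<beta> = Re t - \<alpha> * Re w"
  have lin: "poly (?c [:\<beta>, \<alpha>:]) w = t"
    using w by (simp add: map_poly_pCons complex_eq_iff \<alpha>_def \<beta>_def)
  have "t \<noteq> 0" by (simp add: t_def)
  then have nz: "[:\<beta>, \<alpha>:] \<noteq> 0" using lin by auto
  define q where "q = g * [:\<beta>, \<alpha>:]"
  have "q \<noteq> 0" using \<open>g \<noteq> 0\<close> nz by (simp only: q_def mult_eq_0_iff) simp
  moreover have "degree q < d"
    using degree_mult_le[of g "[:\<beta>, \<alpha>:]"] deg degree_pCons_le[of \<beta> "[:\<alpha>:]"] unfolding q_def by simp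
  ultimately have pos: "qform {..<d} (hermite d a) (coeff q) > 0"
    using pd unfolding pos_def_on_iff_poly by blast
  have qw: "poly (?c q) w = 0 \<or> poly (?c q) w = \<i>"
    unfolding q_def map_poly_of_real_mult poly_mult lin by (simp add: t_def)
  have "Re ((poly (?c q) (z l))\<^sup>2) \<le> 0" if "l < d" for l
  proof -
    have "poly (?c ?Q) (z l) = (z l - w) * (z l - cnj w)"
      by (simp add: map_poly_pCons complex_eq_iff cmod_power2) (simp add: power2_eq_square algebra_simps)
    moreover have "poly (?c ?Q) (z l) * poly (?c g) (z l) = 0"
      using root[OF that] unfolding g map_poly_of_real_mult poly_mult .
    ultimately consider "poly (?c g) (z l) = 0" | "z l = w" | "z l = cnj w" by auto
    then show ?thesis
    proof cases
      case 1
      then show ?thesis by (simp only: q_def map_poly_of_real_mult poly_mult) simp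
    next
      case 2
      then show ?thesis using qw by auto
    next
      case 3
      have "poly (?c q) (cnj w) = cnj (poly (?c q) w)"
        by (rule poly_cnj_real[symmetric]) (simp add: coeff_map_poly)
      then show ?thesis using qw 3 by auto
    qed
  qed
  then have "Re (\<Sum>l<d. (poly (?c q) (z l))\<^sup>2) \<le> 0"
    unfolding Re_sum by (intro sum_nonpos) auto
  then show False
    using pos unfolding hermite_form[OF z \<open>degree q < d\<close>, symmetric] by simp
qed

lemma card_real_roots_iff_pos_def:
  "card {x. poly (monic_poly d a) x = 0} = d \<longleftrightarrow> pos_def_on {..<d} (hermite d a)"
proof -
  define f where "f = monic_poly d a"
  define R where "R = {x. poly f x = 0}"
  let ?c = "map_poly complex_of_real"
  have lc: "lead_coeff f = 1" "degree f = d"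
    using coeff_monic_poly[where j = 0 and d = d and a = a] by (simp_all add: f_def degree_monic_poly)
  then have "f \<noteq> 0" by auto
  then have R: "finite R" "card R \<le> d"
    using card_poly_roots_bound[of f] poly_roots_finite[of f] by (auto simp: R_def lc)
  obtain z where z: "?c f = (\<Prod>l<d. [:- z l, 1:])"
    using complex_factorization[OF lc(1)] unfolding lc(2) .
  note hf = hermite_form[OF z[unfolded f_def]]
  have root: "poly (?c f) w = 0 \<longleftrightarrow> w \<in> z ` {..<d}" for w
    unfolding z by (auto simp: poly_prod)
  show ?thesis
    unfolding f_def[symmetric] R_def[symmetric]
  proof
    assume card: "card R = d"
    \<comment> \<open>The \<open>d\<close> real roots exhaust the at most \<open>d\<close> complex roots.\<close>
    have "complex_of_real ` R \<subseteq> z ` {..<d}"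
      by (auto simp: R_def poly_map_of_real simp flip: root)
    moreover have "card (complex_of_real ` R) = d"
      using card by (simp add: card_image inj_on_def)
    ultimately have eq: "complex_of_real ` R = z ` {..<d}"
      using card_image_le[of "{..<d}" z] by (intro card_seteq) auto
    show "pos_def_on {..<d} (hermite d a)"
      unfolding pos_def_on_iff_poly
    proof (intro allI impI)
      fix q :: "real poly" assume q: "q \<noteq> 0 \<and> degree q < d"
      have val: "poly (?c q) (z l) = complex_of_real (poly q (Re (z l)))" if "l < d" for l
      proof -
        have "z l \<in> complex_of_real ` R" using eq that by auto
        then show ?thesis by (auto simp: poly_map_of_real)
      qed
      have "complex_of_real (qform {..<d} (hermite d a) (coeff q))
          = complex_of_real (\<Sum>l<d. (poly q (Re (z l)))\<^sup>2)"
        using q by (simp add: hf val)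
      then have "qform {..<d} (hermite d a) (coeff q) = (\<Sum>l<d. (poly q (Re (z l)))\<^sup>2)"
        unfolding of_real_eq_iff .
      moreover have "\<not> R \<subseteq> {x. poly q x = 0}"
        using card_mono[of "{x. poly q x = 0}" R] poly_roots_finite[of q] card_poly_roots_bound[of q] q card
        by auto
      then obtain x where "x \<in> R" "poly q x \<noteq> 0" by auto
      moreover from this obtain l where "l < d" "z l = complex_of_real x"
        using eq by (metis imageE imageI lessThan_iff)
      ultimately show "qform {..<d} (hermite d a) (coeff q) > 0"
        by (auto intro!: sum_pos2[of _ l])
    qed
  next
    assume pd: "pos_def_on {..<d} (hermite d a)"
    show "card R = d"
    proof (rule ccontr)
      assume "card R \<noteq> d"
      \<comment> \<open>A nonzero polynomial of degree below \<open>d\<close> that vanishes at every root.\<close>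
      define q where "q = (\<Prod>x\<in>R. [:- x, 1:])"
      have "degree q = card R"
        unfolding q_def by (subst degree_prod_eq_sum_degree) auto
      then have deg: "degree q < d" using R \<open>card R \<noteq> d\<close> by simp
      moreover have "q \<noteq> 0" using R by (simp add: q_def)
      ultimately have "qform {..<d} (hermite d a) (coeff q) > 0"
        using pd unfolding pos_def_on_iff_poly by blast
      moreover have "poly (?c q) (z l) = 0" if "l < d" for l
      proof -
        have "Im (z l) = 0" using pos_def_hermite_imp_real[OF z[unfolded f_def] pd that] .
        then have zl: "z l = complex_of_real (Re (z l))" by (simp add: complex_eq_iff)
        have "poly (?c f) (z l) = 0" using root that by auto
        then have "poly f (Re (z l)) = 0" by (subst (asm) zl) (simp add: poly_map_of_real)
        then have "poly q (Re (z l)) = 0" using R by (auto simp: q_def poly_prod R_def)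
        then show ?thesis by (subst zl) (simp add: poly_map_of_real)
      qed
      ultimately show False using hf[OF deg] by simp
    qed
  qed
qed

theorem theorem5p6:
  fixes d :: nat
  assumes "d \<ge> 1"
  shows "\<exists>F :: nat \<Rightarrow> real_mpoly.
           (\<forall>k \<in> {2..d}. F k \<in> polys_in d \<and> substitutable_homogeneous (F k)) \<and>
           (\<forall>a :: nat \<Rightarrow> real.
              card {x :: real. poly (monic_poly d a) x = 0} = d \<longleftrightarrow>
              (\<forall>k \<in> {2..d}. mpoly_eval (F k) a > 0))"
proof -
  have "\<exists>F. F \<in> polys_in d \<and> substitutable_homogeneous F \<and>
      (\<forall>a. mpoly_eval F a = reduced (hermite d a) (k - 1) (k - 1) (k - 1))" for k
  proof -
    have "weighted d (i + j) (\<lambda>a. hermite d a i j)" for i j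
      unfolding hermite_def by (rule weighted_power_sum)
    from weighted_reduced[OF this, of "k - 1"] obtain w
      where "weighted d w (\<lambda>a. reduced (hermite d a) (k - 1) (k - 1) (k - 1))" by blast
    then show ?thesis
      unfolding weighted_def substitutable_homogeneous_def by metis
  qed
  then obtain F where F: "\<And>k. F k \<in> polys_in d" "\<And>k. substitutable_homogeneous (F k)"
    "\<And>k a. mpoly_eval (F k) a = reduced (hermite d a) (k - 1) (k - 1) (k - 1)"
    by metis
  have "card {x. poly (monic_poly d a) x = 0} = d \<longleftrightarrow> (\<forall>k \<in> {2..d}. mpoly_eval (F k) a > 0)" for a
  proof -
    have "card {x. poly (monic_poly d a) x = 0} = d \<longleftrightarrow> (\<forall>k<d. reduced (hermite d a) k k k > 0)"
      unfolding card_real_roots_iff_pos_def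
      by (rule pos_def_iff_pivots) (simp add: hermite_def add.commute)
    also have "\<dots> \<longleftrightarrow> (\<forall>k \<in> {2..d}. mpoly_eval (F k) a > 0)"
    proof (intro iffI ballI allI impI)
      fix k assume as: "\<forall>k<d. reduced (hermite d a) k k k > 0" "k \<in> {2..d}"
      then have "k - 1 < d" by auto
      then show "mpoly_eval (F k) a > 0" unfolding F(3) by (rule as(1)[rule_format])
    next
      fix k assume as: "\<forall>k \<in> {2..d}. mpoly_eval (F k) a > 0" "k < d"
      show "reduced (hermite d a) k k k > 0"
      proof (cases k)
        case 0
        \<comment> \<open>The first pivot is \<open>p\<^sub>0 = d\<close>, which imposes no condition.\<close>
        then show ?thesis using assms by (simp add: hermite_def power_sum_0)
      next
        case (Suc n)
        then show ?thesis using as(2) bspec[OF as(1), of "Suc k"] by (simp add: F(3))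
      qed
    qed
    finally show ?thesis .
  qed
  with F(1,2) show ?thesis by blast
qed

end
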